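(* For an Armendariz ring $R$, the following are equivalent: (1) $R$ is LNZS. (2) The polynomial ring $R[x]$ is LNZS. (3) The Laurent polynomial ring $R[x,x^{-1}]$ is LNZS.
   Context: All rings are associative with identity; in $R[x]$ and $R[x,x^{-1}]$ the indeterminate $x$ commutes with the elements of $R$. $N(R)$ is the set of nilpotent elements of $R$; for $a\in R$, $l(a)=\{y\in R: ya=0\}$. A ring $R$ is LNZS (left nil zero semicommutative) if $l(a)$ is a two-sided ideal of $R$ for every $a\in N(R)$. A ring $R$ is Armendariz if whenever $f(x)=\sum_{i=0}^n w_ix^i$ and $g(x)=\sum_{j=0}^m h_jx^j$ in $R[x]$ satisfy $f(x)g(x)=0$, then $w_ih_j=0$ for all $i,j$. *)

theory Defs
  imports "HOL-Algebra.UnivPoly" "HOL-Algebra.Ideal"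
begin

definition nilpotents :: "('a, 'm) ring_scheme \<Rightarrow> 'a set"
  where "nilpotents R =
    {a \<in> carrier R. \<exists>n::nat. n > 0 \<and> a [^]\<^bsub>R\<^esub> n = \<zero>\<^bsub>R\<^esub>}"

definition left_ann :: "('a, 'm) ring_scheme \<Rightarrow> 'a \<Rightarrow> 'a set"
  where "left_ann R a = {y \<in> carrier R. y \<otimes>\<^bsub>R\<^esub> a = \<zero>\<^bsub>R\<^esub>}"

definition LNZS :: "('a, 'm) ring_scheme \<Rightarrow> bool"
  where "LNZS R \<longleftrightarrow> ring R \<and> (\<forall>a \<in> nilpotents R. ideal (left_ann R a) R)"

(* UP R is the polynomial ring for an arbitrary, not necessarily commutative, ring R. The indices
   i and j need no bound, because the coefficients beyond the degree are zero. *)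
definition Armendariz :: "('a, 'm) ring_scheme \<Rightarrow> bool"
  where "Armendariz R \<longleftrightarrow> ring R \<and>
    (\<forall>f \<in> carrier (UP R). \<forall>g \<in> carrier (UP R).
      f \<otimes>\<^bsub>UP R\<^esub> g = \<zero>\<^bsub>UP R\<^esub> \<longrightarrow>
      (\<forall>i j. coeff (UP R) f i \<otimes>\<^bsub>R\<^esub> coeff (UP R) g j = \<zero>\<^bsub>R\<^esub>))"

(* R[x, 1/x], in the style of UP: a Laurent polynomial is its family of coefficients indexed by
   the integers, of which only finitely many are nonzero. The product is the convolution; its
   sum is taken over the support of the left factor, so that it is finite. *)
definition laurent :: "('a, 'm) ring_scheme \<Rightarrow> (int \<Rightarrow> 'a) set"
  where "laurent R = {f. f \<in> UNIV \<rightarrow> carrier R \<and> finite {i. f i \<noteq> \<zero>\<^bsub>R\<^esub>}}"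

definition LP :: "('a, 'm) ring_scheme \<Rightarrow> (int \<Rightarrow> 'a) ring"
  where "LP R = \<lparr>
    carrier = laurent R,
    mult = (\<lambda>f g n. \<Oplus>\<^bsub>R\<^esub>i \<in> {i. f i \<noteq> \<zero>\<^bsub>R\<^esub>}. f i \<otimes>\<^bsub>R\<^esub> g (n - i)),
    one = (\<lambda>i. if i = 0 then \<one>\<^bsub>R\<^esub> else \<zero>\<^bsub>R\<^esub>),
    zero = (\<lambda>i. \<zero>\<^bsub>R\<^esub>),
    add = (\<lambda>f g i. f i \<oplus>\<^bsub>R\<^esub> g i)\<rparr>"

end

theory Submission
  imports Defs
begin

text \<open>
  LNZS passes to every ring that embeds, which gives (3) \<open>\<Longrightarrow>\<close> (2) \<open>\<Longrightarrow>\<close> (1). For (1) \<open>\<Longrightarrow>\<close> (3), multiplying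
  Laurent polynomials by powers of \<open>x\<close> turns them into polynomials, so the Armendariz property
  also holds for Laurent polynomials. It implies that every coefficient of a nilpotent Laurent
  polynomial \<open>f\<close> is nilpotent, and that \<open>y f = 0\<close> means \<open>y\<^sub>i f\<^sub>j = 0\<close> for all \<open>i, j\<close>. As \<open>R\<close> is LNZS,
  \<open>y\<^sub>i r f\<^sub>j = 0\<close> for every \<open>r\<close> in \<open>R\<close>, and so \<open>y h f = 0\<close> for every \<open>h\<close>.
\<close>

section \<open>LNZS rings\<close>

text \<open>A left annihilator is always a left ideal, so the only real demand is that it absorbs
  right factors. Later proofs use this elementwise form.\<close>

lemma LNZS_iff:
  fixes R (structure)
  assumes "ring R"
  shows "LNZS R \<longleftrightarrow>
    (\<forall>a \<in> nilpotents R. \<forall>y \<in> carrier R. \<forall>r \<in> carrier R. y \<otimes> a = \<zero> \<longrightarrow> y \<otimes> r \<otimes> a = \<zero>)"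
    (is "_ \<longleftrightarrow> ?C")
proof
  assume L: "LNZS R"
  show ?C
  proof (intro ballI impI)
    fix a y r assume a: "a \<in> nilpotents R" and "y \<in> carrier R" "r \<in> carrier R" "y \<otimes> a = \<zero>"
    moreover from L a have "ideal (left_ann R a) R" by (simp add: LNZS_def)
    ultimately have "y \<otimes> r \<in> left_ann R a"
      by (intro ideal.I_r_closed) (auto simp: left_ann_def)
    then show "y \<otimes> r \<otimes> a = \<zero>" by (simp add: left_ann_def)
  qed
next
  interpret ring R by fact
  assume C: ?C
  have "ideal (left_ann R a) R" if a: "a \<in> nilpotents R" for a
  proof (rule idealI)
    have [simp]: "a \<in> carrier R" using a by (simp add: nilpotents_def)
    show "subgroup (left_ann R a) (add_monoid R)"
      by (rule add.subgroupI) (auto simp: left_ann_def l_distr l_minus simp flip: a_inv_def)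
    show "x \<otimes> y \<in> left_ann R a" if "y \<in> left_ann R a" "x \<in> carrier R" for x y
      using that by (simp add: left_ann_def m_assoc)
    show "y \<otimes> x \<in> left_ann R a" if "y \<in> left_ann R a" "x \<in> carrier R" for x y
      using that C a by (simp add: left_ann_def)
  qed (fact \<open>ring R\<close>)
  then show "LNZS R" using \<open>ring R\<close> by (simp add: LNZS_def)
qed

text \<open>A homomorphism carries nilpotents and the equation y a = 0 into \<open>S\<close>, where
  the image of \<open>r\<close> may be inserted; injectivity brings the result back to
  \<open>R\<close>.\<close>

lemma LNZS_inj_hom:
  assumes "ring R" and S: "LNZS S" and h: "h \<in> ring_hom R S" and inj: "inj_on h (carrier R)"
  shows "LNZS R"
proof -
  have "ring S" using S by (simp add: LNZS_def)
  interpret ring_hom_ring R S h by (rule ring_hom_ringI2) fact+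
  have eq0: "x = \<zero>\<^bsub>R\<^esub>" if "h x = \<zero>\<^bsub>S\<^esub>" "x \<in> carrier R" for x
    using that inj by (metis hom_zero inj_onD R.zero_closed)
  show ?thesis
    unfolding LNZS_iff[OF \<open>ring R\<close>]
  proof (intro ballI impI)
    fix a y r
    assume a: "a \<in> nilpotents R" and yr: "y \<in> carrier R" "r \<in> carrier R"
      and y0: "y \<otimes>\<^bsub>R\<^esub> a = \<zero>\<^bsub>R\<^esub>"
    from a have a': "a \<in> carrier R" by (simp add: nilpotents_def)
    have "h a \<in> nilpotents S"
      using a by (auto simp: nilpotents_def simp flip: hom_nat_pow)
    moreover have "h y \<otimes>\<^bsub>S\<^esub> h a = \<zero>\<^bsub>S\<^esub>" using y0 yr a' by (simp flip: hom_mult)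
    ultimately have "h y \<otimes>\<^bsub>S\<^esub> h r \<otimes>\<^bsub>S\<^esub> h a = \<zero>\<^bsub>S\<^esub>"
      using S yr unfolding LNZS_iff[OF \<open>ring S\<close>] by simp
    then show "y \<otimes>\<^bsub>R\<^esub> r \<otimes>\<^bsub>R\<^esub> a = \<zero>\<^bsub>R\<^esub>"
      using yr a' by (intro eq0) simp_all
  qed
qed

section \<open>Laurent polynomials\<close>

lemma LP_simps:
  "carrier (LP R) = laurent R"
  "f \<otimes>\<^bsub>LP R\<^esub> g = (\<lambda>n. \<Oplus>\<^bsub>R\<^esub>i \<in> {i. f i \<noteq> \<zero>\<^bsub>R\<^esub>}. f i \<otimes>\<^bsub>R\<^esub> g (n - i))"
  "\<one>\<^bsub>LP R\<^esub> = (\<lambda>i. if i = 0 then \<one>\<^bsub>R\<^esub> else \<zero>\<^bsub>R\<^esub>)"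
  "\<zero>\<^bsub>LP R\<^esub> = (\<lambda>i. \<zero>\<^bsub>R\<^esub>)"
  "f \<oplus>\<^bsub>LP R\<^esub> g = (\<lambda>i. f i \<oplus>\<^bsub>R\<^esub> g i)"
  by (simp_all add: LP_def)

lemma carrier_UP: "carrier (UP R) = up R"
  by (simp add: UP_def)

lemma coeff_UP: "p \<in> up R \<Longrightarrow> coeff (UP R) p n = p n"
  by (simp add: UP_def)

lemma laurent_closed: "f \<in> laurent R \<Longrightarrow> f i \<in> carrier R"
  by (auto simp: laurent_def)

lemma laurent_finite: "f \<in> laurent R \<Longrightarrow> finite {i. f i \<noteq> \<zero>\<^bsub>R\<^esub>}"
  by (simp add: laurent_def)

text \<open>The Laurent polynomial \<open>x\<^bsup>-k\<^esup> p\<close>.\<close>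

definition shift :: "('a, 'm) ring_scheme \<Rightarrow> int \<Rightarrow> (nat \<Rightarrow> 'a) \<Rightarrow> int \<Rightarrow> 'a"
  where "shift R k p = (\<lambda>i. if 0 \<le> i + k then p (nat (i + k)) else \<zero>\<^bsub>R\<^esub>)"

definition const :: "('a, 'm) ring_scheme \<Rightarrow> 'a \<Rightarrow> int \<Rightarrow> 'a"
  where "const R c = (\<lambda>i. if i = 0 then c else \<zero>\<^bsub>R\<^esub>)"

context ring
begin

lemma const_laurent: "c \<in> carrier R \<Longrightarrow> const R c \<in> laurent R"
  by (auto simp: laurent_def const_def)

lemma shift_inject: "shift R k p = shift R k q \<longleftrightarrow> p = q"
proof
  assume eq: "shift R k p = shift R k q"
  show "p = q"
  proof
    fix n
    from eq have "shift R k p (int n - k) = shift R k q (int n - k)" by simp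
    then show "p n = q n" by (simp add: shift_def)
  qed
qed simp

lemma shift_support: "{i. shift R k p i \<noteq> \<zero>} = (\<lambda>j. int j - k) ` {j. p j \<noteq> \<zero>}"
proof (intro equalityI subsetI)
  fix i assume i: "i \<in> {i. shift R k p i \<noteq> \<zero>}"
  then have "i = int (nat (i + k)) - k" "p (nat (i + k)) \<noteq> \<zero>"
    by (auto simp: shift_def split: if_splits)
  then show "i \<in> (\<lambda>j. int j - k) ` {j. p j \<noteq> \<zero>}" by blast
qed (auto simp: shift_def)

lemma up_finite:
  assumes "p \<in> up R" shows "finite {j. p j \<noteq> \<zero>}"
proof -
  from assms obtain n where "bound \<zero> n p" by blast
  then have "{j. p j \<noteq> \<zero>} \<subseteq> {..n}" by (auto intro: bound_below)
  then show ?thesis by (rule finite_subset) simp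
qed

lemma shift_laurent: "p \<in> up R \<Longrightarrow> shift R k p \<in> laurent R"
  using up_finite[of p] mem_upD[of p R]
  by (auto simp: laurent_def shift_support) (auto simp: shift_def)

text \<open>All large \<open>k\<close> are allowed, so that finitely many Laurent polynomials can share one \<open>k\<close>.\<close>

lemma laurent_shift:
  assumes f: "f \<in> laurent R"
  shows "\<exists>m. \<forall>k\<ge>m. \<exists>p \<in> up R. f = shift R k p"
proof -
  have fin: "finite {i. f i \<noteq> \<zero>}" using f by (rule laurent_finite)
  obtain a b where a: "\<And>i. f i \<noteq> \<zero> \<Longrightarrow> a \<le> i" and b: "\<And>i. f i \<noteq> \<zero> \<Longrightarrow> i \<le> b"
    using bdd_below_finite[OF fin] bdd_above_finite[OF fin]
    unfolding bdd_below_def bdd_above_def by auto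
  show ?thesis
  proof (intro exI allI impI)
    \<comment> \<open>The threshold is \<open>- a\<close>: from there on, adding \<open>k\<close>
      makes every exponent in the support of \<open>f\<close> nonnegative.\<close>
    fix k assume k: "- a \<le> k"
    let ?p = "\<lambda>n. f (int n - k)"
    have "bound \<zero> (nat (b + k)) ?p"
    proof
      fix n assume "nat (b + k) < n"
      then have "\<not> int n - k \<le> b" by linarith
      with b show "?p n = \<zero>" by blast
    qed
    then have "?p \<in> up R" using laurent_closed[OF f] by blast
    moreover have "f i = shift R k ?p i" for i
      using a[of i] k by (cases "f i = \<zero>") (auto simp: shift_def)
    then have "f = shift R k ?p" by blast
    ultimately show "\<exists>p \<in> up R. f = shift R k p" by blast
  qed
qed

lemma shift_add:
  assumes "p \<in> up R" "q \<in> up R"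
  shows "shift R k p \<oplus>\<^bsub>LP R\<^esub> shift R k q = shift R k (p \<oplus>\<^bsub>UP R\<^esub> q)"
  using assms by (auto simp: LP_simps UP_def shift_def)

text \<open>Both sides are the same convolution, since x is central and exponents add. Through this
  lemma, identities between products pass from \<open>UP R\<close> to \<open>LP R\<close>.\<close>

lemma shift_mult:
  assumes p: "p \<in> up R" and q: "q \<in> up R"
  shows "shift R k p \<otimes>\<^bsub>LP R\<^esub> shift R l q = shift R (k + l) (p \<otimes>\<^bsub>UP R\<^esub> q)"
proof
  fix n
  note closed [simp] = mem_upD[OF p] mem_upD[OF q]
  \<comment> \<open>\<open>?N\<close> is the exponent in the product of \<open>p\<close> and
    \<open>q\<close> that corresponds to \<open>n\<close>; \<open>?t\<close> reads \<open>q\<close>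
    as zero at negative exponents.\<close>
  let ?N = "n + (k + l)"
  let ?t = "\<lambda>j. p j \<otimes> (if int j \<le> ?N then q (nat (?N - int j)) else \<zero>)"
  have "(shift R k p \<otimes>\<^bsub>LP R\<^esub> shift R l q) n =
      (\<Oplus>i \<in> (\<lambda>j. int j - k) ` {j. p j \<noteq> \<zero>}. shift R k p i \<otimes> shift R l q (n - i))"
    by (simp add: LP_simps shift_support)
  also have "\<dots> = (\<Oplus>j \<in> {j. p j \<noteq> \<zero>}. shift R k p (int j - k) \<otimes> shift R l q (n - (int j - k)))"
    by (rule add.finprod_reindex) (auto simp: shift_def inj_on_def)
  also have "\<dots> = (\<Oplus>j \<in> {j. p j \<noteq> \<zero>}. ?t j)"
    by (rule add.finprod_cong') (auto simp: shift_def algebra_simps)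
  also have "\<dots> = shift R (k + l) (p \<otimes>\<^bsub>UP R\<^esub> q) n"
  proof (cases "0 \<le> ?N")
    case False
    then have "(\<Oplus>j \<in> {j. p j \<noteq> \<zero>}. ?t j) = \<zero>"
      by (intro add.finprod_one_eqI) auto
    with False show ?thesis by (simp add: shift_def)
  next
    case True
    have "(\<Oplus>j \<in> {j. p j \<noteq> \<zero>}. ?t j) = (\<Oplus>j \<in> {..nat ?N}. p j \<otimes> q (nat ?N - j))"
    \<comment> \<open>The index sets differ only in zero terms: \<open>p j\<close> vanishes off the
      support, and \<open>?t j\<close> has the default value zero once \<open>j\<close> exceeds
      \<open>?N\<close>.\<close>
    proof (rule add.finprod_mono_neutral_cong)
      fix j assume "j \<in> {j. p j \<noteq> \<zero>} \<inter> {..nat ?N}"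
      with True have "int j \<le> ?N" "nat (?N - int j) = nat ?N - j" by auto
      then show "?t j = p j \<otimes> q (nat ?N - j)" by simp
    qed (use True up_finite[OF p] in auto)
    with True p q show ?thesis by (simp add: shift_def UP_def)
  qed
  finally show "(shift R k p \<otimes>\<^bsub>LP R\<^esub> shift R l q) n = shift R (k + l) (p \<otimes>\<^bsub>UP R\<^esub> q) n" .
qed

section \<open>The ring structure on Laurent polynomials\<close>

lemma LP_one_eq_shift: "\<one>\<^bsub>LP R\<^esub> = shift R 0 \<one>\<^bsub>UP R\<^esub>"
  by (auto simp: LP_simps shift_def UP_def)

text \<open>The additive group laws hold coefficientwise. A law with products involves at most three
  elements; written as shifts by one common \<open>k\<close>, it reduces to the same law in
  \<open>UP R\<close>.\<close>

lemma LP_ring: "ring (LP R)"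
proof -
  interpret P: UP_ring R "UP R" by unfold_locales
  note [simp] = carrier_UP[symmetric]
  \<comment> \<open>The \<open>k\<close> must be common because \<open>shift_add\<close> combines
    only shifts by equal amounts.\<close>
  have common3: "\<exists>k. \<exists>p \<in> up R. \<exists>q \<in> up R. \<exists>r \<in> up R.
      f = shift R k p \<and> g = shift R k q \<and> h = shift R k r"
    if fgh: "f \<in> laurent R" "g \<in> laurent R" "h \<in> laurent R" for f g h
  proof -
    obtain a where a: "\<forall>k\<ge>a. \<exists>p \<in> up R. f = shift R k p"
      using laurent_shift[OF fgh(1)] ..
    obtain b where b: "\<forall>k\<ge>b. \<exists>p \<in> up R. g = shift R k p"
      using laurent_shift[OF fgh(2)] ..
    obtain c where c: "\<forall>k\<ge>c. \<exists>p \<in> up R. h = shift R k p"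
      using laurent_shift[OF fgh(3)] ..
    define k where "k = max a (max b c)"
    then have "a \<le> k" "b \<le> k" "c \<le> k" by auto
    with a b c show ?thesis by meson
  qed
  have mult_closed: "f \<otimes>\<^bsub>LP R\<^esub> g \<in> laurent R" if fg: "f \<in> laurent R" "g \<in> laurent R" for f g
  proof -
    from common3[OF fg fg(2)] obtain k p q where "p \<in> up R" "q \<in> up R"
      "f = shift R k p" "g = shift R k q" by blast
    then show ?thesis by (simp add: shift_mult shift_laurent)
  qed
  have add_closed: "f \<oplus>\<^bsub>LP R\<^esub> g \<in> laurent R" if fg: "f \<in> laurent R" "g \<in> laurent R" for f g
  proof -
    from common3[OF fg fg(2)] obtain k p q where "p \<in> up R" "q \<in> up R"
      "f = shift R k p" "g = shift R k q" by blast
    then show ?thesis by (simp add: shift_add shift_laurent)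
  qed
  have group: "abelian_group (LP R)"
  proof (rule abelian_groupI)
    show "\<zero>\<^bsub>LP R\<^esub> \<in> carrier (LP R)" by (simp add: LP_simps laurent_def)
    fix f assume f: "f \<in> carrier (LP R)"
    note [simp] = laurent_closed[OF f[unfolded LP_simps]]
    show "\<zero>\<^bsub>LP R\<^esub> \<oplus>\<^bsub>LP R\<^esub> f = f" by (simp add: LP_simps)
    have "{i. \<ominus> f i \<noteq> \<zero>} \<subseteq> {i. f i \<noteq> \<zero>}" by auto
    then have "(\<lambda>i. \<ominus> f i) \<in> laurent R"
      using f by (auto simp: LP_simps laurent_def intro: finite_subset)
    then show "\<exists>g \<in> carrier (LP R). g \<oplus>\<^bsub>LP R\<^esub> f = \<zero>\<^bsub>LP R\<^esub>"
      by (intro bexI[of _ "\<lambda>i. \<ominus> f i"]) (simp_all add: LP_simps l_neg)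
  qed (simp_all add: add_closed LP_simps(1), simp_all add: LP_simps laurent_closed a_ac)
  have monoid: "monoid (LP R)"
  proof (rule monoidI)
    show "\<one>\<^bsub>LP R\<^esub> \<in> carrier (LP R)"
      by (simp add: LP_one_eq_shift LP_simps(1) shift_laurent)
    fix f g h
    assume "f \<in> carrier (LP R)" "g \<in> carrier (LP R)" "h \<in> carrier (LP R)"
    from common3[OF this[unfolded LP_simps(1)]] obtain k p q r where "p \<in> up R" "q \<in> up R" "r \<in> up R"
      "f = shift R k p" "g = shift R k q" "h = shift R k r" by blast
    then show "f \<otimes>\<^bsub>LP R\<^esub> g \<otimes>\<^bsub>LP R\<^esub> h = f \<otimes>\<^bsub>LP R\<^esub> (g \<otimes>\<^bsub>LP R\<^esub> h)"
      by (simp add: shift_mult P.UP_m_assoc add.assoc)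
  next
    fix f assume "f \<in> carrier (LP R)"
    then have "f \<in> laurent R" by (simp add: LP_simps(1))
    from common3[OF this this this] obtain k p where "p \<in> up R" "f = shift R k p" by blast
    then show "\<one>\<^bsub>LP R\<^esub> \<otimes>\<^bsub>LP R\<^esub> f = f" "f \<otimes>\<^bsub>LP R\<^esub> \<one>\<^bsub>LP R\<^esub> = f"
      by (simp_all add: LP_one_eq_shift shift_mult)
  qed (simp add: mult_closed LP_simps(1))
  show ?thesis
  proof (rule ringI[OF group monoid])
    fix f g h
    assume "f \<in> carrier (LP R)" "g \<in> carrier (LP R)" "h \<in> carrier (LP R)"
    from common3[OF this[unfolded LP_simps(1)]] obtain k p q r where "p \<in> up R" "q \<in> up R" "r \<in> up R"
      "f = shift R k p" "g = shift R k q" "h = shift R k r" by blast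
    then show "(f \<oplus>\<^bsub>LP R\<^esub> g) \<otimes>\<^bsub>LP R\<^esub> h = f \<otimes>\<^bsub>LP R\<^esub> h \<oplus>\<^bsub>LP R\<^esub> g \<otimes>\<^bsub>LP R\<^esub> h"
      "h \<otimes>\<^bsub>LP R\<^esub> (f \<oplus>\<^bsub>LP R\<^esub> g) = h \<otimes>\<^bsub>LP R\<^esub> f \<oplus>\<^bsub>LP R\<^esub> h \<otimes>\<^bsub>LP R\<^esub> g"
      by (simp_all add: shift_mult shift_add P.UP_l_distr P.UP_r_distr)
  qed
qed

text \<open>This is the inclusion of R[x] in R[x, 1/x]: a shift by 0 keeps all exponents.\<close>

lemma shift_ring_hom: "shift R 0 \<in> ring_hom (UP R) (LP R)"
  by (rule ring_hom_memI)
    (simp_all add: carrier_UP LP_simps(1) shift_laurent shift_mult shift_add LP_one_eq_shift)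

section \<open>The Armendariz condition on Laurent polynomials\<close>

lemma const_mult:
  assumes "c \<in> carrier R" "f \<in> laurent R"
  shows "const R c \<otimes>\<^bsub>LP R\<^esub> f = (\<lambda>i. c \<otimes> f i)"
\<comment> \<open>The product sums over the support of its left factor, which is {0} for nonzero
  \<open>c\<close> and empty otherwise.\<close>
proof (cases "c = \<zero>")
  case False
  then have "{i::int. (if i = 0 then c else \<zero>) \<noteq> \<zero>} = {0}" by auto
  with assms show ?thesis by (simp add: LP_simps const_def laurent_closed)
qed (use assms in \<open>simp add: LP_simps const_def laurent_closed\<close>)

lemma Armendariz_LP:
  assumes A: "Armendariz R" and f: "f \<in> laurent R" and g: "g \<in> laurent R"
    and fg: "f \<otimes>\<^bsub>LP R\<^esub> g = \<zero>\<^bsub>LP R\<^esub>"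
  shows "f i \<otimes> g j = \<zero>"
proof -
  from laurent_shift[OF f] obtain k p where p: "p \<in> up R" "f = shift R k p" by (meson order_refl)
  from laurent_shift[OF g] obtain l q where q: "q \<in> up R" "g = shift R l q" by (meson order_refl)
  \<comment> \<open>The zero Laurent polynomial is the shift of the zero polynomial by any amount,
    so \<open>shift_inject\<close> applies.\<close>
  have "shift R (k + l) (p \<otimes>\<^bsub>UP R\<^esub> q) = shift R (k + l) \<zero>\<^bsub>UP R\<^esub>"
    using fg p q by (auto simp: shift_mult LP_simps(4)) (auto simp: shift_def UP_def)
  then have "p \<otimes>\<^bsub>UP R\<^esub> q = \<zero>\<^bsub>UP R\<^esub>" by (simp add: shift_inject)
  then have "coeff (UP R) p m \<otimes> coeff (UP R) q n = \<zero>" for m n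
    using A p q by (simp add: Armendariz_def carrier_UP)
  then have "p m \<otimes> q n = \<zero>" for m n using p q by (simp add: coeff_UP)
  \<comment> \<open>Coefficients of \<open>f\<close> below \<open>- k\<close> and of
    \<open>g\<close> below \<open>- l\<close> are zero by default; all others are coefficients of
    \<open>p\<close> and \<open>q\<close>.\<close>
  then show ?thesis
    using p q mem_upD[of p R] mem_upD[of q R] by (simp add: shift_def)
qed

text \<open>Induction on \<open>n\<close>: the leftmost factor \<open>f\<close> is absorbed into the
  constant, which changes from \<open>c\<close> to \<open>c \<otimes> f i\<close>. Hence the
  statement carries an arbitrary \<open>c\<close>.\<close>

lemma Armendariz_coeff_nat_pow:
  fixes n :: nat
  assumes A: "Armendariz R" and f: "f \<in> laurent R"
  shows "\<lbrakk>c \<in> carrier R; const R c \<otimes>\<^bsub>LP R\<^esub> f [^]\<^bsub>LP R\<^esub> n = \<zero>\<^bsub>LP R\<^esub>\<rbrakk> \<Longrightarrow> c \<otimes> f i [^] n = \<zero>"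
proof (induction n arbitrary: c)
  case 0
  interpret LP: ring "LP R" by (rule LP_ring)
  have "const R c = \<zero>\<^bsub>LP R\<^esub>"
    using 0 const_laurent[of c] by (simp add: LP_simps(1))
  then have "const R c 0 = \<zero>" by (simp add: LP_simps)
  with 0 show ?case by (simp add: const_def)
next
  case (Suc n)
  interpret LP: ring "LP R" by (rule LP_ring)
  note fi = laurent_closed[OF f]
  have f': "f \<in> carrier (LP R)" and c': "const R c \<in> carrier (LP R)"
    using f const_laurent[OF Suc.prems(1)] by (simp_all add: LP_simps(1))
  have pow: "f [^]\<^bsub>LP R\<^esub> n \<in> laurent R" using LP.nat_pow_closed[OF f'] by (simp add: LP_simps(1))
  have "(const R c \<otimes>\<^bsub>LP R\<^esub> f) \<otimes>\<^bsub>LP R\<^esub> f [^]\<^bsub>LP R\<^esub> n = \<zero>\<^bsub>LP R\<^esub>"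
    using Suc.prems(2) f' c' by (simp only: LP.nat_pow_Suc2 LP.m_assoc LP.nat_pow_closed)
  \<comment> \<open>For fixed \<open>i\<close> and varying \<open>j\<close>, these zeros are all the
    coefficients of the constant \<open>c \<otimes> f i\<close> times the power of
    \<open>f\<close>.\<close>
  then have "(const R c \<otimes>\<^bsub>LP R\<^esub> f) i \<otimes> (f [^]\<^bsub>LP R\<^esub> n) j = \<zero>" for j
    using LP.m_closed[OF c' f'] pow by (intro Armendariz_LP[OF A]) (simp_all add: LP_simps(1))
  then have "const R (c \<otimes> f i) \<otimes>\<^bsub>LP R\<^esub> f [^]\<^bsub>LP R\<^esub> n = \<zero>\<^bsub>LP R\<^esub>"
    using Suc.prems(1) f fi pow by (simp add: const_mult) (simp add: LP_simps)
  then have "(c \<otimes> f i) \<otimes> f i [^] n = \<zero>"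
    using Suc.prems(1) fi by (intro Suc.IH) simp_all
  then show ?case
    using Suc.prems(1) fi by (simp only: nat_pow_Suc2 m_assoc nat_pow_closed)
qed

text \<open>With \<open>\<one>\<close> as the constant, an exponent that kills \<open>f\<close>
  kills each of its coefficients.\<close>

lemma Armendariz_nilpotent_coeff:
  assumes A: "Armendariz R" and f: "f \<in> nilpotents (LP R)"
  shows "f i \<in> nilpotents R"
proof -
  interpret LP: ring "LP R" by (rule LP_ring)
  from f obtain n :: nat where fL: "f \<in> laurent R" and n: "n > 0" "f [^]\<^bsub>LP R\<^esub> n = \<zero>\<^bsub>LP R\<^esub>"
    by (auto simp: nilpotents_def LP_simps(1))
  have "\<one> \<otimes> f i [^] n = \<zero>"
    using n const_laurent[of \<one>]
    by (intro Armendariz_coeff_nat_pow[OF A fL]) (simp_all add: LP_simps(1))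
  with n laurent_closed[OF fL] show ?thesis by (auto simp: nilpotents_def)
qed

lemma LNZS_LP:
  assumes A: "Armendariz R" and L: "LNZS R"
  shows "LNZS (LP R)"
  unfolding LNZS_iff[OF LP_ring]
proof (intro ballI impI)
  fix f y h
  assume f: "f \<in> nilpotents (LP R)" and "y \<in> carrier (LP R)" "h \<in> carrier (LP R)"
    and yf: "y \<otimes>\<^bsub>LP R\<^esub> f = \<zero>\<^bsub>LP R\<^esub>"
  then have y: "y \<in> laurent R" and h: "h \<in> laurent R" and fL: "f \<in> laurent R"
    by (simp_all add: LP_simps(1) nilpotents_def)
  note closed [simp] = laurent_closed[OF y] laurent_closed[OF h] laurent_closed[OF fL]
  have zero: "y i \<otimes> h k \<otimes> f j = \<zero>" for i j k
    using L Armendariz_nilpotent_coeff[OF A f] Armendariz_LP[OF A y fL yf]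
    unfolding LNZS_iff[OF ring_axioms] by simp
  have "(y \<otimes>\<^bsub>LP R\<^esub> h) i \<otimes> f j = \<zero>" for i j
    using laurent_finite[OF y] by (simp add: LP_simps finsum_ldistr zero)
  then show "y \<otimes>\<^bsub>LP R\<^esub> h \<otimes>\<^bsub>LP R\<^esub> f = \<zero>\<^bsub>LP R\<^esub>"
    \<comment> \<open>Only the outer product is unfolded; the inner one stays whole to match the
      preceding fact.\<close>
    by (simp add: LP_simps(2)[of _ "_ \<otimes>\<^bsub>LP R\<^esub> _"] LP_simps(4))
qed

end

theorem corollary2p29:
  fixes R :: "('a, 'm) ring_scheme" (structure)
  assumes "ring R" and "Armendariz R"
  shows "(LNZS R \<longleftrightarrow> LNZS (UP R)) \<and> (LNZS (UP R) \<longleftrightarrow> LNZS (LP R))"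
proof -
  interpret ring R by fact
  interpret P: UP_ring R "UP R" by unfold_locales
  \<comment> \<open>The constants embed \<open>R\<close> in R[x]; coefficient 0 recovers
    \<open>a\<close>.\<close>
  have "inj_on (\<lambda>a. monom (UP R) a 0) (carrier R)"
    by (rule inj_onI) (metis P.coeff_monom)
  then have "LNZS R" if "LNZS (UP R)"
    using LNZS_inj_hom[OF \<open>ring R\<close> that P.const_ring_hom] by simp
  moreover have "LNZS (UP R)" if "LNZS (LP R)"
    using LNZS_inj_hom[OF P.UP_ring that shift_ring_hom] by (simp add: inj_on_def shift_inject)
  moreover have "LNZS (LP R)" if "LNZS R"
    using \<open>Armendariz R\<close> that by (rule LNZS_LP)
  ultimately show ?thesis by blast
qed

end
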